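(* Let $\Omega$ be a locally compact Hausdorff space, $\sigma$ a Radon measure on $\Omega$, $G:\Omega\times\Omega\to[0,+\infty]$ a lower semicontinuous function, $q\in\mathbb{R}\setminus\{0\}$, and let $h>0$ be a lower semicontinuous function in $\Omega$ (the value $+\infty$ being allowed). Suppose that $G$ satisfies the weak domination principle with respect to $h$ (and $\sigma$) with constant $\mathfrak{b}\ge 1$. Suppose that $u$ is a non-negative function such that $u^q\in L^1_{\mathrm{loc}}(\sigma)$, and that $u$ satisfies $$u(x)\ge G(u^q d\sigma)(x)+h(x)\ \text{ in }\Omega\quad\text{if } q>0,\qquad (1)$$ $$u(x)\le -G(u^q d\sigma)(x)+h(x)\ \text{ in }\Omega\quad\text{if } q<0.\qquad (2)$$ (a) If $q>0$, $q\ne1$, then $$u(x)\ge h(x)\left\{1+\mathfrak{b}\left[\Big(1+\frac{(1-q)\,G(h^q d\sigma)(x)}{\mathfrak{b}\,h(x)}\Big)^{\frac1{1-q}}-1\right]\right\},$$ for all $x\in\Omega$ with $h(x)<+\infty$ if $0<q<1$, and for all $x\in\Omega$ with $u(x)<+\infty$ if $q>1$; moreover, in the case $q>1$ necessarily $$G(h^q d\sigma)(x)<\frac{\mathfrak{b}}{q-1}\,h(x)$$ for all $x\in\Omega$ such that $0\le u(x)<+\infty$ and (1) holds. (b) If $q=1$, then for all $x\in\Omega$ with $h(x)<+\infty$, $$u(x)\ge h(x)\left[1+\mathfrak{b}\Big(e^{\mathfrak{b}^{-1}\frac{G(h\,d\sigma)(x)}{h(x)}}-1\Big)\right].$$ (c)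 If $q<0$, then for all $x\in\Omega$ with $h(x)<+\infty$, $$u(x)\le h(x)\left\{1-\mathfrak{b}\left[1-\Big(1-\frac{(1-q)\,G(h^q d\sigma)(x)}{\mathfrak{b}\,h(x)}\Big)^{\frac1{1-q}}\right]\right\},$$ and necessarily $$G(h^q d\sigma)(x)<\frac{\mathfrak{b}}{1-q}\Big[1-(1-\mathfrak{b}^{-1})^{1-q}\Big]h(x)$$ for all $x\in\Omega$ such that $u(x)>0$, $h(x)<+\infty$, and (2) holds.
   Context: For measurable $f\ge0$ write $G(f\,d\sigma)(x)=\int_\Omega G(x,y)f(y)\,d\sigma(y)$. $L^1_{\mathrm{loc}}(\sigma)$ is the space of measurable functions $\sigma$-integrable over compact sets. The function $u$ is measurable with values in $[0,+\infty]$; for $q<0$ the conventions $0^q=+\infty$, $(+\infty)^q=0$ are used, and (2) is understood as $u(x)+G(u^qd\sigma)(x)\le h(x)$. Weak domination principle with respect to $h$ (and $\sigma$) with constant $\mathfrak{b}\ge1$: for any non-negative bounded measurable function $f$ with compact support, if $G(f\,d\sigma)(x)\le h(x)$ for all $x\in\mathrm{supp}(f)$, then $G(f\,d\sigma)(x)\le\mathfrak{b}\,h(x)$ for all $x\in\Omega$. *)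

theory Defs
  imports "HOL-Analysis.Analysis"
begin

definition lower_semicontinuous :: "('a::topological_space \<Rightarrow> 'b::linorder) \<Rightarrow> bool" where
  "lower_semicontinuous f \<longleftrightarrow> (\<forall>c. open {x. c < f x})"

text \<open>Radon measures in the sense of Folland: Borel measures that are finite on compact sets,
  outer regular on Borel sets and inner regular on open sets.\<close>

definition radon_measure :: "'a::topological_space measure \<Rightarrow> bool" where
  "radon_measure M \<longleftrightarrow>
     sets M = sets borel \<and>
     (\<forall>K. compact K \<longrightarrow> emeasure M K < \<infinity>) \<and>
     (\<forall>B \<in> sets borel. emeasure M B = (INF U \<in> {U. B \<subseteq> U \<and> open U}. emeasure M U)) \<and>
     (\<forall>U. open U \<longrightarrow> emeasure M U = (SUP K \<in> {K. K \<subseteq> U \<and> compact K}. emeasure M K))"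

text \<open>Powers of bases in \<open>[0, \<infinity>]\<close>, with \<open>0\<^sup>p = \<infinity>\<close> and \<open>\<infinity>\<^sup>p = 0\<close> for \<open>p < 0\<close>.
  The value for a negative base is irrelevant.\<close>

definition ereal_powr :: "ereal \<Rightarrow> real \<Rightarrow> ereal" where
  "ereal_powr x p =
     (if x = \<infinity> then (if p > 0 then \<infinity> else if p = 0 then 1 else 0)
      else if x = 0 \<and> p < 0 then \<infinity>
      else ereal (real_of_ereal x powr p))"

definition ennreal_powr :: "ennreal \<Rightarrow> real \<Rightarrow> ennreal" where
  "ennreal_powr x p = e2ennreal (ereal_powr (enn2ereal x) p)"

definition ereal_exp :: "ereal \<Rightarrow> ereal" where
  "ereal_exp x = (case x of ereal r \<Rightarrow> ereal (exp r) | PInfty \<Rightarrow> \<infinity> | MInfty \<Rightarrow> 0)"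

text \<open>The potential \<open>G(f d\<sigma>)(x)\<close>.\<close>

definition potential ::
    "('a \<Rightarrow> 'a \<Rightarrow> ennreal) \<Rightarrow> 'a measure \<Rightarrow> ('a \<Rightarrow> ennreal) \<Rightarrow> 'a \<Rightarrow> ennreal" where
  "potential G \<sigma> f x = (\<integral>\<^sup>+ y. G x y * f y \<partial>\<sigma>)"

text \<open>\<open>G(v\<^sup>q d\<sigma>)(x)\<close>, with the conventions of \<open>ennreal_powr\<close>.\<close>

definition power_potential ::
    "('a \<Rightarrow> 'a \<Rightarrow> ennreal) \<Rightarrow> 'a measure \<Rightarrow> ('a \<Rightarrow> ennreal) \<Rightarrow> real \<Rightarrow> 'a \<Rightarrow> ennreal" where
  "power_potential G \<sigma> v q = potential G \<sigma> (\<lambda>y. ennreal_powr (v y) q)"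

definition L1_loc :: "'a::topological_space measure \<Rightarrow> ('a \<Rightarrow> ennreal) \<Rightarrow> bool" where
  "L1_loc \<sigma> f \<longleftrightarrow>
     f \<in> borel_measurable \<sigma> \<and> (\<forall>K. compact K \<longrightarrow> (\<integral>\<^sup>+ y\<in>K. f y \<partial>\<sigma>) < \<infinity>)"

definition supp :: "('a::topological_space \<Rightarrow> real) \<Rightarrow> 'a set" where
  "supp f = closure {x. f x \<noteq> 0}"

definition weak_domination_principle ::
    "('a::topological_space \<Rightarrow> 'a \<Rightarrow> ennreal) \<Rightarrow> 'a measure \<Rightarrow> ('a \<Rightarrow> ennreal) \<Rightarrow> real \<Rightarrow> bool" where
  "weak_domination_principle G \<sigma> h b \<longleftrightarrow>
     (\<forall>f :: 'a \<Rightarrow> real.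
        (\<forall>x. 0 \<le> f x) \<and> bounded (range f) \<and> f \<in> borel_measurable \<sigma> \<and> compact (supp f) \<and>
        (\<forall>x \<in> supp f. potential G \<sigma> (\<lambda>y. ennreal (f y)) x \<le> h x) \<longrightarrow>
        (\<forall>x. potential G \<sigma> (\<lambda>y. ennreal (f y)) x \<le> ennreal b * h x))"

end

theory Submission
  imports Defs
begin

text \<open>Let \<open>f = u\<^sup>q\<close>. On a set where \<open>G(f d\<sigma>) \<le> s h\<close>, the domination principle applied to \<open>f / s\<close>
  restricted to compact subsets gives \<open>\<mu>{w \<le> s} \<le> b h(x) s\<close> for the measure
  \<open>\<mu> = G(x, \<cdot>) f d\<sigma>\<close>, where \<open>w = \<bar>u / h - 1\<bar>\<close>; inequalities (1) and (2) say precisely that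
  \<open>w \<le> s\<close> implies \<open>G(f d\<sigma>) \<le> s h\<close>. For decreasing \<open>\<phi>\<close> the integral of \<open>\<phi>(w)\<close> against a measure of
  mass \<open>T\<close> with this distribution bound is largest when the bound is attained, hence at most
  \<open>b h(x)\<close> times the integral of \<open>\<phi>\<close> over \<open>[0, T / (b h(x))]\<close>. Since \<open>h\<^sup>q = f \<phi>(w)\<close> with
  \<open>\<phi>(t) = (1 + t)\<close> or \<open>(1 - t)\<close> to the power \<open>-q\<close>, this bounds \<open>G(h\<^sup>q d\<sigma>)(x)\<close> by an explicit
  function of \<open>T = G(u\<^sup>q d\<sigma>)(x)\<close>, which is then solved for \<open>T\<close> and inserted into (1) or (2).\<close>

section \<open>Integrals of decreasing functions under a distribution bound\<close>

text \<open>Equality holds for \<open>C\<close> times Lebesgue measure on \<open>{0..\<tau>}\<close>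
  with \<open>w\<close> the identity there, which explains the right-hand side. The derivative is
  required only inside the interval because the antiderivative
  \<open>- ((1 - t) powr (1 - q)) / (1 - q)\<close> may be used up to \<open>\<tau> = 1\<close>,
  beyond which its base is negative.\<close>

lemma nn_integral_antimono_le:
  fixes \<phi> \<Phi> :: "real \<Rightarrow> real" and w :: "'a \<Rightarrow> real"
  assumes w [measurable]: "w \<in> borel_measurable M" and w0: "\<And>y. 0 \<le> w y"
    and C: "0 \<le> C" and \<tau>: "0 \<le> \<tau>"
    and mass: "emeasure M (space M) \<le> ennreal (C * \<tau>)"
    and sublevel: "\<And>s. 0 < s \<Longrightarrow> emeasure M {y \<in> space M. w y \<le> s} \<le> ennreal (C * s)"
    and anti: "\<And>s t. 0 \<le> s \<Longrightarrow> s \<le> t \<Longrightarrow> \<phi> t \<le> \<phi> s"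
    and \<phi>0: "\<And>t. 0 \<le> t \<Longrightarrow> 0 \<le> \<phi> t"
    and cont: "continuous_on {0..\<tau>} \<Phi>"
    and deriv: "\<And>t. 0 < t \<Longrightarrow> t < \<tau> \<Longrightarrow> (\<Phi> has_real_derivative \<phi> t) (at t)"
  shows "(\<integral>\<^sup>+ y. ennreal (\<phi> (w y)) \<partial>M) \<le> ennreal (C * (\<Phi> \<tau> - \<Phi> 0))"
proof -
  \<comment> \<open>Since \<open>\<phi>\<close> decreases, its composition with \<open>w\<close> lies below a step function built from the sets
    \<open>{w \<le> t}\<close>; Abel summation turns the resulting bound into a left Riemann sum of \<open>\<phi>\<close>.\<close>
  have bound: "(\<integral>\<^sup>+ y. ennreal (\<phi> (w y)) \<partial>M)
      \<le> ennreal (C * (\<Phi> \<tau> - \<Phi> 0) + C * \<tau> * (\<phi> 0 - \<phi> \<tau>) * inverse (real (Suc k)))" for k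
  proof -
    define n where "n = Suc k"
    define \<delta> where "\<delta> = \<tau> / real n"
    define t where "t i = \<delta> * real i" for i
    define d where "d i = \<phi> (t i) - \<phi> (t (Suc i))" for i
    have n0: "n > 0" by (simp add: n_def)
    have \<delta>0: "0 \<le> \<delta>" using \<tau> by (simp add: \<delta>_def)
    have t0: "0 \<le> t i" for i using \<delta>0 by (simp add: t_def)
    have tS: "t (Suc i) = t i + \<delta>" for i by (simp add: t_def algebra_simps)
    have tn: "t n = \<tau>" using n0 by (simp add: t_def \<delta>_def)
    have t_le: "t i \<le> \<tau>" if "i \<le> n" for i
      using that \<delta>0 unfolding tn[symmetric] t_def by (simp add: mult_left_mono)
    have d0: "0 \<le> d i" for i using anti[of "t i" "t (Suc i)"] t0 tS \<delta>0 by (simp add: d_def)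
    have step: "\<phi> (w y) \<le> \<phi> (t m) + (\<Sum>i<m. d i * indicator {y. w y \<le> t (Suc i)} y)" for m y
    proof (induction m)
      case 0
      show ?case using anti[of 0 "w y"] w0[of y] by (simp add: t_def)
    next
      case (Suc m)
      show ?case
      proof (cases "w y \<le> t (Suc m)")
        case True
        then show ?thesis using Suc by (simp add: d_def)
      next
        case False
        have "\<phi> (w y) \<le> \<phi> (t (Suc m))" using anti[of "t (Suc m)" "w y"] t0 False by simp
        moreover have "0 \<le> (\<Sum>i<Suc m. d i * indicator {y. w y \<le> t (Suc i)} y)"
          by (intro sum_nonneg mult_nonneg_nonneg d0) auto
        ultimately show ?thesis by linarith
      qed
    qed
    \<comment> \<open>For \<open>\<tau> = 0\<close> all nodes are \<open>0\<close>, where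
      \<open>sublevel\<close> says nothing; the bound on the total mass takes over.\<close>
    have meas: "emeasure M {y \<in> space M. w y \<le> t (Suc i)} \<le> ennreal (C * t (Suc i))" for i
    proof (cases "\<tau> = 0")
      case True
      have "emeasure M {y \<in> space M. w y \<le> t (Suc i)} \<le> emeasure M (space M)"
        by (rule emeasure_space)
      then show ?thesis using mass True by simp
    next
      case False
      then have "0 < t (Suc i)" using \<tau> n0 by (simp add: t_def \<delta>_def)
      then show ?thesis by (rule sublevel)
    qed
    have abel: "\<phi> (t m) * t m + (\<Sum>i<m. d i * t (Suc i)) = (\<Sum>i<m. \<phi> (t i) * \<delta>)" for m
    proof (induction m)
      case 0
      show ?case by (simp add: t_def)
    next
      case (Suc m)
      have "\<phi> (t (Suc m)) * t (Suc m) + d m * t (Suc m) = \<phi> (t m) * t m + \<phi> (t m) * \<delta>"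
        unfolding d_def tS by (simp add: algebra_simps)
      with Suc show ?case by simp
    qed
    have mvt_step: "\<phi> (t (Suc i)) * \<delta> \<le> \<Phi> (t (Suc i)) - \<Phi> (t i)" if "i < n" for i
    proof (cases "\<delta> = 0")
      case True
      then show ?thesis by (simp add: t_def)
    next
      case False
      have lt: "t i < t (Suc i)" using False \<delta>0 by (simp add: tS)
      have le: "t (Suc i) \<le> \<tau>" using t_le[of "Suc i"] that by simp
      have d\<Phi>: "(\<Phi> has_derivative (*) (\<phi> z)) (at z)" if "t i < z" "z < t (Suc i)" for z
        using deriv[of z] that t0[of i] le by (simp add: has_field_derivative_def)
      have "continuous_on {t i..t (Suc i)} \<Phi>"
        by (rule continuous_on_subset[OF cont]) (use t0 le in auto)
      from mvt[OF lt this d\<Phi>]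
      obtain z where z: "t i < z" "z < t (Suc i)" "\<Phi> (t (Suc i)) - \<Phi> (t i) = \<phi> z * \<delta>"
        by (auto simp: tS)
      have "\<phi> (t (Suc i)) \<le> \<phi> z" by (rule anti) (use t0[of i] z in auto)
      then show ?thesis using z(3) \<delta>0 by (simp add: mult.commute mult_left_mono)
    qed
    \<comment> \<open>The right Riemann sum is at most \<open>\<Phi> \<tau> - \<Phi> 0\<close> by
      the mean value theorem. The left sum exceeds it by a telescoping amount, of order
      \<open>\<delta>\<close>, which vanishes as the partition is refined.\<close>
    have riemann: "(\<Sum>i<n. \<phi> (t i) * \<delta>) \<le> (\<Phi> \<tau> - \<Phi> 0) + \<delta> * (\<phi> 0 - \<phi> \<tau>)"
    proof -
      have "(\<Sum>i<n. \<phi> (t i) * \<delta>) = (\<Sum>i<n. \<phi> (t (Suc i)) * \<delta>) + (\<Sum>i<n. \<phi> (t i) - \<phi> (t (Suc i))) * \<delta>"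
        by (simp add: sum_distrib_right[symmetric] sum_subtractf left_diff_distrib)
      also have "(\<Sum>i<n. \<phi> (t i) - \<phi> (t (Suc i))) = \<phi> 0 - \<phi> \<tau>"
        using sum_lessThan_telescope'[of "\<lambda>i. \<phi> (t i)" n] tn by (simp add: t_def)
      also have "(\<Sum>i<n. \<phi> (t (Suc i)) * \<delta>) \<le> (\<Sum>i<n. \<Phi> (t (Suc i)) - \<Phi> (t i))"
        by (intro sum_mono mvt_step) auto
      also have "\<dots> = \<Phi> \<tau> - \<Phi> 0"
        using sum_lessThan_telescope[of "\<lambda>i. \<Phi> (t i)" n] tn by (simp add: t_def)
      finally show ?thesis by (simp add: algebra_simps)
    qed
    have "(\<integral>\<^sup>+ y. ennreal (\<phi> (w y)) \<partial>M)
        \<le> (\<integral>\<^sup>+ y. ennreal (\<phi> \<tau>) + (\<Sum>i<n. ennreal (d i) * indicator {y \<in> space M. w y \<le> t (Suc i)} y) \<partial>M)"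
    proof (rule nn_integral_mono)
      fix y assume y: "y \<in> space M"
      have "ennreal (\<phi> (w y)) \<le> ennreal (\<phi> (t n) + (\<Sum>i<n. d i * indicator {y. w y \<le> t (Suc i)} y))"
        by (rule ennreal_leI[OF step])
      also have "\<dots> = ennreal (\<phi> \<tau>) + (\<Sum>i<n. ennreal (d i * indicator {y. w y \<le> t (Suc i)} y))"
        using d0 by (subst ennreal_plus) (auto intro!: sum_nonneg \<phi>0 \<tau> simp: tn sum_ennreal)
      also have "\<dots> = ennreal (\<phi> \<tau>) + (\<Sum>i<n. ennreal (d i) * indicator {y \<in> space M. w y \<le> t (Suc i)} y)"
        using y by (intro arg_cong2[of _ _ _ _ "(+)"] sum.cong) (auto simp: indicator_def)
      finally show "ennreal (\<phi> (w y)) \<le> \<dots>" .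
    qed
    also have "\<dots> = ennreal (\<phi> \<tau>) * emeasure M (space M)
        + (\<Sum>i<n. ennreal (d i) * emeasure M {y \<in> space M. w y \<le> t (Suc i)})"
    proof (subst nn_integral_add)
      show "(\<integral>\<^sup>+ y. ennreal (\<phi> \<tau>) \<partial>M)
          + (\<integral>\<^sup>+ y. (\<Sum>i<n. ennreal (d i) * indicator {y \<in> space M. w y \<le> t (Suc i)} y) \<partial>M) =
        ennreal (\<phi> \<tau>) * emeasure M (space M)
          + (\<Sum>i<n. ennreal (d i) * emeasure M {y \<in> space M. w y \<le> t (Suc i)})"
        by (subst nn_integral_sum) (simp_all add: nn_integral_cmult_indicator)
    qed measurable
    \<comment> \<open>The constant part \<open>\<phi> \<tau>\<close> is charged to the total mass
      and each jump \<open>d i\<close> to its sublevel set. The former becomes the boundary term of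
      the Abel summation.\<close>
    also have "\<dots> \<le> ennreal (\<phi> \<tau>) * ennreal (C * \<tau>) + (\<Sum>i<n. ennreal (d i) * ennreal (C * t (Suc i)))"
      by (intro add_mono mult_left_mono sum_mono mass meas) auto
    also have "\<dots> = ennreal (\<phi> \<tau> * (C * \<tau>) + (\<Sum>i<n. d i * (C * t (Suc i))))"
      using d0 C t0 \<phi>0 \<tau>
      by (subst ennreal_plus) (auto intro!: sum_nonneg mult_nonneg_nonneg simp: ennreal_mult sum_ennreal[symmetric])
    also have "\<phi> \<tau> * (C * \<tau>) + (\<Sum>i<n. d i * (C * t (Suc i))) = C * (\<Sum>i<n. \<phi> (t i) * \<delta>)"
      unfolding abel[of n, symmetric] tn by (simp add: sum_distrib_left algebra_simps)
    also have "ennreal \<dots> \<le> ennreal (C * ((\<Phi> \<tau> - \<Phi> 0) + \<delta> * (\<phi> 0 - \<phi> \<tau>)))"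
      by (intro ennreal_leI mult_left_mono riemann C)
    also have "C * ((\<Phi> \<tau> - \<Phi> 0) + \<delta> * (\<phi> 0 - \<phi> \<tau>))
        = C * (\<Phi> \<tau> - \<Phi> 0) + C * \<tau> * (\<phi> 0 - \<phi> \<tau>) * inverse (real (Suc k))"
      unfolding \<delta>_def n_def by (simp only: divide_inverse) (simp add: algebra_simps)
    finally show ?thesis .
  qed
  have "(\<lambda>k. C * (\<Phi> \<tau> - \<Phi> 0) + C * \<tau> * (\<phi> 0 - \<phi> \<tau>) * inverse (real (Suc k)))
      \<longlonglongrightarrow> C * (\<Phi> \<tau> - \<Phi> 0) + C * \<tau> * (\<phi> 0 - \<phi> \<tau>) * 0"
    by (intro tendsto_intros LIMSEQ_inverse_real_of_nat)
  then have "(\<lambda>k. ennreal (C * (\<Phi> \<tau> - \<Phi> 0) + C * \<tau> * (\<phi> 0 - \<phi> \<tau>) * inverse (real (Suc k))))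
      \<longlonglongrightarrow> ennreal (C * (\<Phi> \<tau> - \<Phi> 0))"
    by (intro tendsto_ennrealI) simp
  then show ?thesis by (rule LIMSEQ_le_const) (use bound in blast)
qed

section \<open>Inner regularity on sets of finite measure\<close>

text \<open>Only open sets are inner regular by definition. Take an open \<open>U\<close> containing
  \<open>E\<close> with almost the same measure, a compact \<open>K\<close> nearly filling
  \<open>U\<close>, and an open \<open>V\<close> of small measure covering \<open>U - E\<close>.
  Then \<open>K - V\<close> is compact and contained in \<open>E\<close>, and what it misses of
  \<open>E\<close> lies in \<open>(U - K) \<union> V\<close>.\<close>

lemma radon_measure_inner_regular:
  fixes M :: "'a::t2_space measure"
  assumes M: "radon_measure M" and E: "E \<in> sets borel" and fin: "emeasure M E < \<infinity>" and e: "0 < (e::real)"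
  shows "\<exists>F. compact F \<and> F \<subseteq> E \<and> emeasure M (E - F) \<le> ennreal e"
proof -
  have sets: "sets M = sets borel" using M by (simp add: radon_measure_def)
  have outer: "\<exists>U. B \<subseteq> U \<and> open U \<and> emeasure M U < emeasure M B + ennreal \<epsilon>"
    if B: "B \<in> sets borel" and B_fin: "emeasure M B < \<infinity>" and \<epsilon>: "0 < \<epsilon>" for B \<epsilon>
  proof -
    have "emeasure M B < emeasure M B + ennreal \<epsilon>"
      using B_fin \<epsilon> ennreal_add_left_cancel_less[of "emeasure M B" 0 "ennreal \<epsilon>"] by simp
    moreover have "emeasure M B = (INF U \<in> {U. B \<subseteq> U \<and> open U}. emeasure M U)"
      using M B by (auto simp: radon_measure_def)
    ultimately have "(INF U \<in> {U. B \<subseteq> U \<and> open U}. emeasure M U) < emeasure M B + ennreal \<epsilon>"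
      by simp
    then show ?thesis by (auto simp: INF_less_iff)
  qed
  \<comment> \<open>The loss is one \<open>\<epsilon>\<close> from \<open>U - K\<close> and two from
    \<open>V\<close>, so a quarter of \<open>e\<close> suffices.\<close>
  define \<epsilon> where "\<epsilon> = e / 4"
  have \<epsilon>: "0 < \<epsilon>" using e by (simp add: \<epsilon>_def)
  obtain U where U: "E \<subseteq> U" "open U" "emeasure M U < emeasure M E + ennreal \<epsilon>"
    using outer[OF E fin \<epsilon>] by auto
  have U_fin: "emeasure M U < \<infinity>"
    using U(3) fin by (metis infinity_ennreal_def less_top order.strict_trans top.not_eq_extremum)
  obtain K where K: "K \<subseteq> U" "compact K" "emeasure M U \<le> emeasure M K + ennreal \<epsilon>"
  \<comment> \<open>Subtraction in \<open>ennreal\<close> is truncated, so subtracting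
    \<open>\<epsilon>\<close> lowers the measure strictly only if it is positive.\<close>
  proof (cases "emeasure M U = 0")
    case True
    then show ?thesis using that[of "{}"] by simp
  next
    case False
    have "emeasure M U - ennreal \<epsilon> < emeasure M U"
      using False U_fin \<epsilon> by (intro ennreal_between) (auto simp: zero_less_iff_neq_zero)
    also have "emeasure M U = (SUP K \<in> {K. K \<subseteq> U \<and> compact K}. emeasure M K)"
      using M U(2) by (auto simp: radon_measure_def)
    finally obtain K where K: "K \<subseteq> U" "compact K" "emeasure M U - ennreal \<epsilon> < emeasure M K"
      by (auto simp: less_SUP_iff)
    then have "emeasure M U \<le> emeasure M K + ennreal \<epsilon>"
      using ennreal_minus_le_iff[of "emeasure M U" "ennreal \<epsilon>" "emeasure M K"]
      by (simp add: add.commute less_imp_le)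
    then show ?thesis using that[of K] K by simp
  qed
  have borel [measurable]: "U \<in> sets M" "K \<in> sets M" "E \<in> sets M"
    using U K E by (auto simp: sets compact_imp_closed)
  have "emeasure M (U - E) = emeasure M U - emeasure M E"
    using U fin by (intro emeasure_Diff) auto
  also have "\<dots> \<le> ennreal \<epsilon>"
    using U(3) fin by (auto simp: ennreal_minus_le_iff less_imp_le)
  finally have UE: "emeasure M (U - E) \<le> ennreal \<epsilon>" .
  have "emeasure M (U - E) < \<infinity>"
    using UE by (metis ennreal_less_top infinity_ennreal_def order_le_less_trans)
  moreover have "U - E \<in> sets borel" using U E by auto
  ultimately obtain V where V: "U - E \<subseteq> V" "open V" "emeasure M V < emeasure M (U - E) + ennreal \<epsilon>"
    using outer[OF _ _ \<epsilon>] by blast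
  have [measurable]: "V \<in> sets M" using V by (simp add: sets)
  show ?thesis
  proof (intro exI conjI)
    show "compact (K - V)" using K V by (simp add: compact_diff)
    show "K - V \<subseteq> E" using K V by auto
    have "emeasure M K \<le> emeasure M U" by (rule emeasure_mono) (use K in auto)
    then have "emeasure M K \<noteq> \<infinity>" using U_fin by auto
    then have UK: "emeasure M (U - K) \<le> ennreal \<epsilon>"
      using K by (subst emeasure_Diff) (auto simp: ennreal_minus_le_iff)
    have "emeasure M (E - (K - V)) \<le> emeasure M ((U - K) \<union> V)"
      by (rule emeasure_mono) (use U in auto)
    also have "\<dots> \<le> emeasure M (U - K) + emeasure M V"
      by (rule emeasure_subadditive) auto
    also have "\<dots> \<le> ennreal \<epsilon> + (ennreal \<epsilon> + ennreal \<epsilon>)"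
      using V(3) UE UK by (intro add_mono) (auto intro: order.trans[OF less_imp_le] add_right_mono)
    also have "\<dots> \<le> ennreal e"
      using e by (simp add: \<epsilon>_def ennreal_plus[symmetric] del: ennreal_plus)
    finally show "emeasure M (E - (K - V)) \<le> ennreal e" .
  qed
qed

section \<open>Sublevel sets under the weak domination principle\<close>

text \<open>The principle is applied to \<open>f / s\<close> cut off outside \<open>F\<close>. The
  bound \<open>c\<close> and the compactness of \<open>F\<close> make this an admissible test
  function. Its support stays in \<open>F\<close> because \<open>F\<close> is closed, and there its
  potential is at most that of \<open>f\<close> divided by \<open>s\<close>, hence at most
  \<open>h\<close>.\<close>

lemma weak_domination_compact:
  fixes \<sigma> :: "'a::t2_space measure"
  assumes sets: "sets \<sigma> = sets borel" and wdp: "weak_domination_principle G \<sigma> h b"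
    and G: "\<And>x. G x \<in> borel_measurable \<sigma>" and f: "f \<in> borel_measurable \<sigma>"
    and b: "0 \<le> b" and s: "0 < (s::real)"
    and F: "compact F" "\<And>y. y \<in> F \<Longrightarrow> f y \<le> ennreal c"
      "\<And>y. y \<in> F \<Longrightarrow> potential G \<sigma> f y \<le> ennreal s * h y"
  shows "(\<integral>\<^sup>+ y\<in>F. G x y * f y \<partial>\<sigma>) \<le> ennreal (b * s) * h x"
proof -
  note [measurable] = f G
  have [measurable]: "F \<in> sets \<sigma>" using F(1) by (simp add: sets compact_imp_closed)
  \<comment> \<open>Test functions are real valued; \<open>enn2real\<close> loses nothing because
    \<open>f\<close> is finite on \<open>F\<close>.\<close>
  define g where "g y = enn2real (f y) * indicator F y / s" for y
  have g: "ennreal (g y) = ennreal (1 / s) * (f y * indicator F y)" for y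
  proof (cases "y \<in> F")
    case True
    then have "f y < top" using F(2) by (metis ennreal_less_top order_le_less_trans)
    then obtain r where "f y = ennreal r" "0 \<le> r" by (cases "f y") auto
    then show ?thesis using True s by (simp add: g_def ennreal_mult[symmetric])
  qed (simp add: g_def)
  have potential_g: "potential G \<sigma> (\<lambda>y. ennreal (g y)) z
      = ennreal (1 / s) * (\<integral>\<^sup>+ y\<in>F. G z y * f y \<partial>\<sigma>)" for z
    unfolding potential_def g by (subst nn_integral_cmult[symmetric]) (auto simp: ac_simps)
  have supp: "supp g \<subseteq> F"
    unfolding supp_def using F(1)
    by (intro closure_minimal compact_imp_closed) (auto simp: g_def indicator_def split: if_splits)
  have "compact (F \<inter> supp g)" by (intro compact_Int_closed F) (simp add: supp_def)
  then have "compact (supp g)" using supp by (simp add: Int_absorb1)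
  moreover have "bounded (range g)"
  proof (rule boundedI)
    fix r assume "r \<in> range g"
    then obtain y where r: "r = g y" by auto
    \<comment> \<open>The absolute value covers negative \<open>c\<close>, for which
      \<open>ennreal c\<close> is \<open>0\<close>.\<close>
    have "g y \<le> \<bar>c\<bar> / s"
    proof (cases "y \<in> F")
      case True
      have "enn2real (f y) \<le> \<bar>c\<bar>"
        using F(2)[OF True] by (intro enn2real_leI order.trans[OF F(2)[OF True]] ennreal_leI) auto
      then show ?thesis using True s by (simp add: g_def divide_right_mono)
    qed (use s in \<open>simp add: g_def\<close>)
    then show "norm r \<le> \<bar>c\<bar> / s" using s by (simp add: r g_def)
  qed
  moreover have "g \<in> borel_measurable \<sigma>" unfolding g_def by measurable
  moreover have "\<forall>y. 0 \<le> g y" using s by (simp add: g_def)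
  moreover have "potential G \<sigma> (\<lambda>y. ennreal (g y)) z \<le> h z" if "z \<in> supp g" for z
  proof -
    have "(\<integral>\<^sup>+ y\<in>F. G z y * f y \<partial>\<sigma>) \<le> potential G \<sigma> f z"
      unfolding potential_def by (intro nn_integral_mono) (auto simp: indicator_def)
    also have "\<dots> \<le> ennreal s * h z" using F(3) supp that by auto
    finally have "ennreal (1 / s) * (\<integral>\<^sup>+ y\<in>F. G z y * f y \<partial>\<sigma>) \<le> ennreal (1 / s) * (ennreal s * h z)"
      by (rule mult_left_mono) simp
    also have "\<dots> = h z"
      using s ennreal_mult[of "1 / s" s] by (simp add: mult.assoc[symmetric])
    finally show ?thesis by (simp add: potential_g)
  qed
  ultimately have "potential G \<sigma> (\<lambda>y. ennreal (g y)) x \<le> ennreal b * h x"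
    using wdp unfolding weak_domination_principle_def by blast
  then have "ennreal s * (ennreal (1 / s) * (\<integral>\<^sup>+ y\<in>F. G x y * f y \<partial>\<sigma>)) \<le> ennreal s * (ennreal b * h x)"
    unfolding potential_g by (rule mult_left_mono) simp
  then show ?thesis
    using s b ennreal_mult'[of s "1 / s"] ennreal_mult[of b s]
    by (simp add: mult.assoc[symmetric]) (simp add: mult.commute)
qed

text \<open>The compact case is passed to the limit twice. Up to a null set of the density measure,
  the sublevel set is the increasing union of the sets \<open>E n\<close>, on which \<open>f\<close>
  is bounded and \<open>G x y * f y\<close> is bounded below. Each \<open>E n\<close> has finite
  \<open>\<sigma>\<close>-measure by Markov's inequality, and increasing compact subsets fill it up
  to a \<open>\<sigma>\<close>-null set.\<close>

lemma weak_domination_sublevel: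
  fixes \<sigma> :: "'a::t2_space measure"
  assumes \<sigma>: "radon_measure \<sigma>" and wdp: "weak_domination_principle G \<sigma> h b"
    and G: "\<And>x. G x \<in> borel_measurable \<sigma>" and f: "f \<in> borel_measurable \<sigma>"
    and w: "w \<in> borel_measurable \<sigma>" and b: "0 \<le> b" and s: "0 < (s::real)"
    and w_le: "\<And>y. f y < \<infinity> \<Longrightarrow> w y \<le> s \<Longrightarrow> potential G \<sigma> f y \<le> ennreal s * h y"
    and fin: "potential G \<sigma> f x < \<infinity>"
  shows "emeasure (density \<sigma> (\<lambda>y. G x y * f y)) {y. w y \<le> s} \<le> ennreal (b * s) * h x"
proof -
  note [measurable] = f G w
  have sets: "sets \<sigma> = sets borel" using \<sigma> by (simp add: radon_measure_def)
  then have space: "space \<sigma> = UNIV" by (metis sets_eq_imp_space_eq space_borel)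
  define \<mu> where "\<mu> = density \<sigma> (\<lambda>y. G x y * f y)"
  have sets_\<mu>: "sets \<mu> = sets \<sigma>" by (simp add: \<mu>_def)
  \<comment> \<open>The measure \<open>\<sigma>\<close> is inner regular only on sets of finite measure, and the whole space need not be
    \<open>\<sigma>\<close>-finite; but the set where \<open>G x y * f y > 0\<close> is, because the potential at \<open>x\<close> is finite.\<close>
  define E where "E n = {y. w y \<le> s \<and> f y \<le> ennreal (real n) \<and> ennreal (inverse (real (Suc n))) \<le> G x y * f y}"
    for n :: nat
  have E_eq: "E n = {y\<in>space \<sigma>. w y \<le> s \<and> f y \<le> ennreal (real n) \<and> ennreal (inverse (real (Suc n))) \<le> G x y * f y}" for n
    by (simp add: E_def space)
  have E [measurable]: "E n \<in> sets \<sigma>" for n unfolding E_eq by measurable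
  have E_fin: "emeasure \<sigma> (E n) < \<infinity>" for n
  proof -
    have "ennreal (inverse (real (Suc n))) * emeasure \<sigma> (E n)
        = (\<integral>\<^sup>+ y. ennreal (inverse (real (Suc n))) * indicator (E n) y \<partial>\<sigma>)"
      by (simp add: nn_integral_cmult_indicator)
    also have "\<dots> \<le> potential G \<sigma> f x"
      unfolding potential_def by (intro nn_integral_mono) (auto simp: E_def indicator_def)
    finally have "ennreal (inverse (real (Suc n))) * emeasure \<sigma> (E n) < top" using fin by simp
    moreover have "ennreal (inverse (real (Suc n))) \<noteq> 0" by (simp add: ennreal_eq_0_iff)
    ultimately show ?thesis by (auto simp: ennreal_mult_less_top)
  qed
  have E_le: "emeasure \<mu> (E n) \<le> ennreal (b * s) * h x" for n
  proof -
    have "\<exists>F. compact F \<and> F \<subseteq> E n \<and> emeasure \<sigma> (E n - F) \<le> ennreal (inverse (real (Suc k)))" for k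
      by (rule radon_measure_inner_regular[OF \<sigma> _ E_fin]) (use E sets in auto)
    then obtain F where F: "\<And>k. compact (F k)" "\<And>k. F k \<subseteq> E n"
      "\<And>k. emeasure \<sigma> (E n - F k) \<le> ennreal (inverse (real (Suc k)))" by metis
    \<comment> \<open>Finite unions make the approximating compact sets increase, so that continuity
      from below applies.\<close>
    define D where "D k = (\<Union>i\<le>k. F i)" for k
    have D: "compact (D k)" "D k \<subseteq> E n" for k
      using F by (auto simp: D_def intro!: compact_UN)
    have [measurable]: "F k \<in> sets \<sigma>" "D k \<in> sets \<sigma>" for k
      using F D by (auto simp: sets compact_imp_closed)
    have "emeasure \<mu> (D k) \<le> ennreal (b * s) * h x" for k
    proof -
      have "emeasure \<mu> (D k) = (\<integral>\<^sup>+ y\<in>D k. G x y * f y \<partial>\<sigma>)"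
        unfolding \<mu>_def by (rule emeasure_density) auto
      also have "\<dots> \<le> ennreal (b * s) * h x"
      proof (rule weak_domination_compact[OF sets wdp G f b s D(1)])
        fix y assume "y \<in> D k"
        then have y: "w y \<le> s" "f y \<le> ennreal (real n)" using D(2) by (auto simp: E_def)
        then show "f y \<le> ennreal (real n)" by simp
        have "f y < \<infinity>" using y(2) by (metis ennreal_less_top infinity_ennreal_def order_le_less_trans)
        then show "potential G \<sigma> f y \<le> ennreal s * h y" using w_le y(1) by simp
      qed
      finally show ?thesis .
    qed
    moreover have "(SUP k. emeasure \<mu> (D k)) = emeasure \<mu> (\<Union>k. D k)"
    proof (rule SUP_emeasure_incseq)
      show "range D \<subseteq> sets \<mu>" by (auto simp: sets_\<mu>)
      show "incseq D" by (rule incseq_SucI) (auto simp: D_def atMost_Suc)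
    qed
    ultimately have UD: "emeasure \<mu> (\<Union>k. D k) \<le> ennreal (b * s) * h x"
      by (metis SUP_least)
    define N where "N = E n - (\<Union>k. D k)"
    have [measurable]: "N \<in> sets \<sigma>" by (simp add: N_def)
    have "emeasure \<sigma> N \<le> ennreal (inverse (real (Suc k)))" for k
    proof -
      have "emeasure \<sigma> N \<le> emeasure \<sigma> (E n - F k)"
        by (rule emeasure_mono) (auto simp: N_def D_def)
      then show ?thesis using F(3) order.trans by blast
    qed
    moreover have "(\<lambda>k. ennreal (inverse (real (Suc k)))) \<longlonglongrightarrow> ennreal 0"
      by (intro tendsto_ennrealI LIMSEQ_inverse_real_of_nat)
    ultimately have "emeasure \<sigma> N \<le> ennreal 0" by (intro LIMSEQ_le_const) blast+
    then have "N \<in> null_sets \<sigma>" by (auto simp: null_sets_def)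
    then have "AE y in \<sigma>. y \<notin> N" by (rule AE_not_in)
    then have "AE y in \<sigma>. 0 < G x y * f y \<longrightarrow> y \<in> E n \<longrightarrow> y \<in> (\<Union>k. D k)"
      by (rule eventually_mono) (auto simp: N_def)
    then have "AE y in \<mu>. y \<in> E n \<longrightarrow> y \<in> (\<Union>k. D k)"
      unfolding \<mu>_def by (subst AE_density) measurable
    then have "emeasure \<mu> (E n) \<le> emeasure \<mu> (\<Union>k. D k)"
      by (rule emeasure_mono_AE) (simp add: sets_\<mu>)
    then show ?thesis using UD by simp
  qed
  have "incseq E"
  proof (rule incseq_SucI, rule subsetI)
    fix n y assume "y \<in> E n"
    moreover have "ennreal (inverse (real (Suc (Suc n)))) \<le> ennreal (inverse (real (Suc n)))"
      "ennreal (real n) \<le> ennreal (real (Suc n))"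
      by (intro ennreal_leI; simp add: field_simps)+
    ultimately show "y \<in> E (Suc n)"
      unfolding E_def mem_Collect_eq by (meson order.trans)
  qed
  then have "(SUP n. emeasure \<mu> (E n)) = emeasure \<mu> (\<Union>n. E n)"
    by (intro SUP_emeasure_incseq) (auto simp: sets_\<mu>)
  then have UE: "emeasure \<mu> (\<Union>n. E n) \<le> ennreal (b * s) * h x"
    using E_le by (metis SUP_least)
  have "AE y in \<sigma>. G x y * f y \<noteq> \<infinity>"
    using fin unfolding potential_def by (intro nn_integral_noteq_infinite) auto
  \<comment> \<open>Points with \<open>G x y * f y = 0\<close> lie in no \<open>E n\<close>, but
    \<open>\<mu>\<close> does not charge them. At the remaining points the product is positive and
    finite, so \<open>f y\<close> is finite as well.\<close>
  then have "AE y in \<mu>. y \<in> {y. w y \<le> s} \<longrightarrow> y \<in> (\<Union>n. E n)"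
    unfolding \<mu>_def
  proof (subst AE_density, measurable, eventually_elim, intro impI)
    fix y assume *: "G x y * f y \<noteq> \<infinity>" "0 < G x y * f y" "y \<in> {y. w y \<le> s}"
    have "f y \<noteq> \<infinity>" using * by (auto simp: ennreal_mult_top ennreal_mult_eq_top_iff)
    then obtain r where r: "f y = ennreal r" "0 \<le> r" by (cases "f y") auto
    obtain c where c: "G x y * f y = ennreal c" "0 < c" using * by (cases "G x y * f y") auto
    obtain n where n: "r < real n" using reals_Archimedean2 by blast
    obtain m where m: "inverse (real (Suc m)) < c" using reals_Archimedean c(2) by blast
    have "inverse (real (Suc (max m n))) \<le> inverse (real (Suc m))" by (simp add: field_simps)
    then have "ennreal (inverse (real (Suc (max m n)))) \<le> ennreal c"
      using m by (intro ennreal_leI) linarith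
    moreover have "ennreal r \<le> ennreal (real (max m n))"
      using n by (intro ennreal_leI) simp
    ultimately have "y \<in> E (max m n)"
      using *(3) c(1) r(1) unfolding E_def by simp
    then show "y \<in> (\<Union>n. E n)" by blast
  qed
  then have "emeasure \<mu> {y. w y \<le> s} \<le> emeasure \<mu> (\<Union>n. E n)"
    by (rule emeasure_mono_AE) (simp add: sets_\<mu>)
  then show ?thesis using UE by (simp add: \<mu>_def)
qed

section \<open>From sublevel bounds to potentials\<close>

text \<open>The integral bound is used with \<open>C = b * H\<close> and
  \<open>\<tau> = T / (b * H)\<close>, so that \<open>C * \<tau> = T\<close> is the mass of the
  density measure. Points with \<open>f y = \<infinity>\<close> may be left out of
  \<open>w_le\<close> and \<open>g_le\<close>: since the potential at \<open>x\<close> is finite,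
  those with \<open>G x y > 0\<close> form a \<open>\<sigma>\<close>-null set, and those with
  \<open>G x y = 0\<close> contribute nothing to either potential.\<close>

lemma weak_domination_potential_le:
  fixes \<sigma> :: "'a::t2_space measure" and \<phi> \<Phi> :: "real \<Rightarrow> real" and w :: "'a \<Rightarrow> real"
  assumes \<sigma>: "radon_measure \<sigma>" and wdp: "weak_domination_principle G \<sigma> h b"
    and G [measurable]: "\<And>x. G x \<in> borel_measurable \<sigma>"
    and f [measurable]: "f \<in> borel_measurable \<sigma>"
    and w [measurable]: "w \<in> borel_measurable \<sigma>" and w0: "\<And>y. 0 \<le> w y"
    and b: "0 < b"
    and w_le: "\<And>y s. 0 < s \<Longrightarrow> f y < \<infinity> \<Longrightarrow> w y \<le> s \<Longrightarrow> potential G \<sigma> f y \<le> ennreal s * h y"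
    and g_le: "\<And>y. f y < \<infinity> \<Longrightarrow> g y \<le> f y * ennreal (\<phi> (w y))"
    and H: "h x = ennreal H" "0 < H"
    and T: "potential G \<sigma> f x = ennreal T" "0 \<le> T"
    and \<phi> [measurable]: "\<phi> \<in> borel_measurable borel"
    and anti: "\<And>s t. 0 \<le> s \<Longrightarrow> s \<le> t \<Longrightarrow> \<phi> t \<le> \<phi> s"
    and \<phi>0: "\<And>t. 0 \<le> t \<Longrightarrow> 0 \<le> \<phi> t"
    and cont: "continuous_on {0..T / (b * H)} \<Phi>"
    and deriv: "\<And>t. 0 < t \<Longrightarrow> t < T / (b * H) \<Longrightarrow> (\<Phi> has_real_derivative \<phi> t) (at t)"
  shows "potential G \<sigma> g x \<le> ennreal (b * H * (\<Phi> (T / (b * H)) - \<Phi> 0))"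
proof -
  have space: "space \<sigma> = UNIV"
    using \<sigma> by (metis radon_measure_def sets_eq_imp_space_eq space_borel)
  define \<mu> where "\<mu> = density \<sigma> (\<lambda>y. G x y * f y)"
  have "AE y in \<sigma>. G x y * f y \<noteq> \<infinity>"
    using T unfolding potential_def by (intro nn_integral_noteq_infinite) auto
  then have "potential G \<sigma> g x \<le> (\<integral>\<^sup>+ y. G x y * f y * ennreal (\<phi> (w y)) \<partial>\<sigma>)"
    unfolding potential_def
  proof (intro nn_integral_mono_AE, eventually_elim)
    fix y assume *: "G x y * f y \<noteq> \<infinity>"
    show "G x y * g y \<le> G x y * f y * ennreal (\<phi> (w y))"
    proof (cases "G x y = 0")
      case False
      then have "f y < \<infinity>" using * by (auto simp: ennreal_mult_eq_top_iff less_top)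
      then show ?thesis using g_le[of y] by (simp add: mult.assoc mult_left_mono)
    qed simp
  qed
  also have "\<dots> = (\<integral>\<^sup>+ y. ennreal (\<phi> (w y)) \<partial>\<mu>)"
    unfolding \<mu>_def by (rule nn_integral_density[symmetric]) auto
  also have "\<dots> \<le> ennreal (b * H * (\<Phi> (T / (b * H)) - \<Phi> 0))"
  proof (rule nn_integral_antimono_le[OF _ w0 _ _ _ _ anti \<phi>0 cont deriv])
    show "0 \<le> b * H" "0 \<le> T / (b * H)" using b H T by auto
    show "w \<in> borel_measurable \<mu>" by (simp add: \<mu>_def)
    have "emeasure \<mu> (space \<mu>) = potential G \<sigma> f x"
      unfolding \<mu>_def potential_def by (subst emeasure_density) (auto intro!: nn_integral_cong)
    then show "emeasure \<mu> (space \<mu>) \<le> ennreal (b * H * (T / (b * H)))"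
      using T b H by simp
    fix s :: real assume s: "0 < s"
    have "emeasure \<mu> {y. w y \<le> s} \<le> ennreal (b * s) * h x"
      unfolding \<mu>_def
    proof (rule weak_domination_sublevel[OF \<sigma> wdp G f w _ s])
      show "potential G \<sigma> f y \<le> ennreal s * h y" if "f y < \<infinity>" "w y \<le> s" for y
        by (rule w_le[OF s that])
    qed (use b T in simp_all)
    also have "ennreal (b * s) * h x = ennreal (b * H * s)"
      unfolding H(1) using b s H(2) by (subst ennreal_mult[symmetric]) (simp_all add: mult_ac)
    finally show "emeasure \<mu> {y \<in> space \<mu>. w y \<le> s} \<le> ennreal (b * H * s)"
      by (simp add: \<mu>_def space)
  qed
  finally show ?thesis .
qed

section \<open>Extended powers and measurability of semicontinuous functions\<close>

lemma ennreal_powr_ennreal: "0 < r \<Longrightarrow> ennreal_powr (ennreal r) p = ennreal (r powr p)"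
  by (simp add: ennreal_powr_def ereal_powr_def)

lemma ennreal_powr_top: "p \<noteq> 0 \<Longrightarrow> ennreal_powr top p = (if 0 < p then top else 0)"
  using e2ennreal_ereal[of 0, unfolded zero_ereal_def[symmetric] ennreal_0]
  by (simp add: ennreal_powr_def ereal_powr_def)

lemma ennreal_powr_zero: "p < 0 \<Longrightarrow> ennreal_powr 0 p = top"
  by (simp add: ennreal_powr_def ereal_powr_def zero_ennreal.rep_eq)

lemma lower_semicontinuous_section:
  assumes "lower_semicontinuous (\<lambda>(x, y). G x y)"
  shows "lower_semicontinuous (G x)"
  unfolding lower_semicontinuous_def
proof
  fix c
  have "open {p. c < (case p of (x, y) \<Rightarrow> G x y)}"
    using assms by (simp add: lower_semicontinuous_def)
  moreover have "continuous_on UNIV (Pair x)" by (intro continuous_intros)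
  ultimately have "open (Pair x -` {p. c < (case p of (x, y) \<Rightarrow> G x y)})"
    by (rule open_vimage)
  then show "open {y. c < G x y}" by (simp add: vimage_def)
qed

lemma lower_semicontinuous_borel_measurable:
  fixes f :: "'a::topological_space \<Rightarrow> ennreal"
  assumes "sets M = sets borel" "lower_semicontinuous f"
  shows "f \<in> borel_measurable M"
proof -
  have "f \<in> borel_measurable borel"
    using assms(2) by (intro borel_measurableI_greater) (simp add: lower_semicontinuous_def)
  then show ?thesis using assms(1) measurable_cong_sets by blast
qed

section \<open>Potential bounds for supersolutions and subsolutions\<close>

text \<open>With \<open>w = u / h - 1\<close>, the condition \<open>w \<le> s\<close> means
  \<open>u \<le> (1 + s) h\<close>; cancelling the finite \<open>h\<close> in \<open>ineq\<close>
  leaves the required bound on the potential. Since \<open>1 + w = u / h\<close>, the weight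
  \<open>(1 + w) powr - q\<close> turns the \<open>q\<close>-th power of \<open>u\<close> into that
  of \<open>h\<close>. The antiderivative \<open>\<Phi>\<close> is left open because it is a power
  for \<open>q \<noteq> 1\<close> and a logarithm for \<open>q = 1\<close>.\<close>

lemma supersolution_power_potential_le:
  fixes \<sigma> :: "'a::t2_space measure"
  assumes \<sigma>: "radon_measure \<sigma>" and wdp: "weak_domination_principle G \<sigma> h b"
    and G: "\<And>x. G x \<in> borel_measurable \<sigma>" and h [measurable]: "h \<in> borel_measurable \<sigma>"
    and u [measurable]: "u \<in> borel_measurable \<sigma>"
    and f: "(\<lambda>y. ennreal_powr (u y) q) \<in> borel_measurable \<sigma>"
    and b: "0 < b" and q: "0 < q" and h0: "\<And>x. 0 < h x"
    and ineq: "\<And>x. power_potential G \<sigma> u q x + h x \<le> u x"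
    and H: "h x = ennreal H" "0 < H"
    and T: "power_potential G \<sigma> u q x = ennreal T" "0 \<le> T"
    and deriv: "\<And>t. 0 \<le> t \<Longrightarrow> (\<Phi> has_real_derivative (1 + t) powr - q) (at t)"
  shows "power_potential G \<sigma> h q x \<le> ennreal (b * H * (\<Phi> (T / (b * H)) - \<Phi> 0))"
  unfolding power_potential_def
proof (rule weak_domination_potential_le[where h = h and w = "\<lambda>y. max 0 (enn2real (u y) / enn2real (h y) - 1)"
      and \<phi> = "\<lambda>t. (1 + t) powr - q", OF \<sigma> wdp G f _ _ b _ _ H T[unfolded power_potential_def]])
  \<comment> \<open>Where the power of \<open>u\<close> is finite,
    \<open>0 < h \<le> u < \<infinity>\<close>, so the truncation in \<open>w\<close> is inactive.
    It only keeps \<open>w\<close> nonnegative at points with \<open>u = \<infinity>\<close>, where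
    \<open>enn2real\<close> returns \<open>0\<close>.\<close>
  have finite_values: "\<exists>U K. u y = ennreal U \<and> h y = ennreal K \<and> 0 < K \<and> K \<le> U"
    if "ennreal_powr (u y) q < \<infinity>" for y
  proof -
    have "u y \<noteq> \<infinity>" using that q by (auto simp: ennreal_powr_top)
    then obtain U where U: "u y = ennreal U" "0 \<le> U" by (cases "u y") auto
    have "h y \<le> power_potential G \<sigma> u q y + h y" by simp
    also have "\<dots> \<le> ennreal U" using ineq[of y] U by simp
    finally have "h y \<le> ennreal U" .
    moreover from this obtain K where "h y = ennreal K" "0 \<le> K"
      by (cases "h y") (auto simp: top_unique)
    ultimately show ?thesis using U h0[of y] by auto
  qed
  show "potential G \<sigma> (\<lambda>y. ennreal_powr (u y) q) y \<le> ennreal s * h y"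
    if s: "0 < s" and fin: "ennreal_powr (u y) q < \<infinity>" and le: "max 0 (enn2real (u y) / enn2real (h y) - 1) \<le> s" for s y
  proof -
    obtain U K where UK: "u y = ennreal U" "h y = ennreal K" "0 < K" "K \<le> U"
      using finite_values[OF fin] by blast
    have "U / K - 1 \<le> s" using le UK by simp
    then have *: "U \<le> s * K + K" using UK by (simp add: field_simps)
    have "power_potential G \<sigma> u q y + ennreal K \<le> ennreal U" using ineq[of y] UK by simp
    also have "\<dots> \<le> ennreal (s * K + K)" using * by (rule ennreal_leI)
    also have "\<dots> = ennreal s * h y + ennreal K" using UK s by (simp add: ennreal_mult)
    finally show ?thesis by (simp add: power_potential_def)
  qed
  show "ennreal_powr (h y) q
      \<le> ennreal_powr (u y) q * ennreal ((1 + max 0 (enn2real (u y) / enn2real (h y) - 1)) powr - q)"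
    if fin: "ennreal_powr (u y) q < \<infinity>" for y
  proof -
    obtain U K where UK: "u y = ennreal U" "h y = ennreal K" "0 < K" "K \<le> U"
      using finite_values[OF fin] by blast
    have "1 + max 0 (enn2real (u y) / enn2real (h y) - 1) = U / K"
      using UK by (simp add: max_def field_simps)
    moreover have "U powr q * (U / K) powr - q = K powr q"
      using UK by (simp add: powr_divide powr_minus field_simps)
    ultimately show ?thesis using UK by (simp add: ennreal_powr_ennreal ennreal_mult[symmetric])
  qed
  show "continuous_on {0..T / (b * H)} \<Phi>"
    by (rule DERIV_continuous_on) (use deriv in \<open>auto intro: has_field_derivative_at_within\<close>)
qed (use q deriv in \<open>auto intro!: powr_mono2'\<close>)

text \<open>The counterpart with \<open>w = 1 - u / h\<close> and the weight
  \<open>(1 - w) powr - q\<close>, which decreases in \<open>w\<close> because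
  \<open>- q > 0\<close>. The premise \<open>T \<le> b * H\<close> keeps the interval of integration
  inside \<open>{0..1}\<close>, where the base of the power is nonnegative.\<close>

lemma subsolution_power_potential_le:
  fixes \<sigma> :: "'a::t2_space measure"
  assumes \<sigma>: "radon_measure \<sigma>" and wdp: "weak_domination_principle G \<sigma> h b"
    and G: "\<And>x. G x \<in> borel_measurable \<sigma>" and h [measurable]: "h \<in> borel_measurable \<sigma>"
    and u [measurable]: "u \<in> borel_measurable \<sigma>"
    and f: "(\<lambda>y. ennreal_powr (u y) q) \<in> borel_measurable \<sigma>"
    and b: "0 < b" and q: "q < 0" and h0: "\<And>x. 0 < h x"
    and ineq: "\<And>x. u x + power_potential G \<sigma> u q x \<le> h x"
    and H: "h x = ennreal H" "0 < H"
    and T: "power_potential G \<sigma> u q x = ennreal T" "0 \<le> T" "T \<le> b * H"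
  shows "power_potential G \<sigma> h q x
    \<le> ennreal (b * H * ((1 - (1 - T / (b * H)) powr (1 - q)) / (1 - q)))"
proof -
  \<comment> \<open>An antiderivative of \<open>(1 - t) powr - q\<close> for \<open>t < 1\<close>.
    The weight used below is cut off by \<open>max 0\<close> so that it is decreasing on the whole
    half-line.\<close>
  let ?\<Phi> = "\<lambda>t. - ((1 - t) powr (1 - q)) / (1 - q)"
  have \<tau>: "T / (b * H) \<le> 1" using T b H by simp
  have "power_potential G \<sigma> h q x \<le> ennreal (b * H * (?\<Phi> (T / (b * H)) - ?\<Phi> 0))"
    unfolding power_potential_def
  proof (rule weak_domination_potential_le[where h = h and w = "\<lambda>y. max 0 (1 - enn2real (u y) / enn2real (h y))"
        and \<phi> = "\<lambda>t. max 0 (1 - t) powr - q", OF \<sigma> wdp G f _ _ b _ _ H T(1,2)[unfolded power_potential_def]])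
    have u0: "u y \<noteq> 0" if "ennreal_powr (u y) q < \<infinity>" for y
      using that q by (auto simp: ennreal_powr_zero)
    \<comment> \<open>For negative \<open>q\<close> a finite power excludes \<open>u = 0\<close> but
      allows \<open>u = \<infinity>\<close>, so finiteness of \<open>h\<close> is a separate
      premise. Where \<open>h\<close> is infinite, both pointwise bounds are trivial: the right side
      of the first is \<open>\<infinity>\<close> and the power of \<open>h\<close> is
      \<open>0\<close>.\<close>
    have finite_values: "\<exists>U K. u y = ennreal U \<and> h y = ennreal K \<and> 0 < U \<and> U \<le> K"
      if fin: "ennreal_powr (u y) q < \<infinity>" and h_fin: "h y \<noteq> \<infinity>" for y
    proof -
      obtain K where K: "h y = ennreal K" "0 \<le> K" using h_fin by (cases "h y") auto
      have "u y \<le> u y + power_potential G \<sigma> u q y" by simp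
      also have "\<dots> \<le> ennreal K" using ineq[of y] K by simp
      finally have "u y \<le> ennreal K" .
      moreover from this obtain U where "u y = ennreal U" "0 \<le> U"
        by (cases "u y") (auto simp: top_unique)
      ultimately show ?thesis using K u0[OF fin] by (auto simp: less_le)
    qed
    show "potential G \<sigma> (\<lambda>y. ennreal_powr (u y) q) y \<le> ennreal s * h y"
      if s: "0 < s" and fin: "ennreal_powr (u y) q < \<infinity>"
        and le: "max 0 (1 - enn2real (u y) / enn2real (h y)) \<le> s" for s y
    proof (cases "h y = \<infinity>")
      case True
      then show ?thesis using s by (simp add: ennreal_mult_top)
    next
      case False
      obtain U K where UK: "u y = ennreal U" "h y = ennreal K" "0 < U" "U \<le> K"
        using finite_values[OF fin False] by blast
      have "1 - U / K \<le> s" using le UK by simp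
      then have *: "K \<le> U + s * K" using UK by (simp add: field_simps)
      have "ennreal U + power_potential G \<sigma> u q y \<le> ennreal K" using ineq[of y] UK by simp
      also have "\<dots> \<le> ennreal (U + s * K)" using * by (rule ennreal_leI)
      also have "\<dots> = ennreal U + ennreal s * h y" using UK s by (simp add: ennreal_mult)
      finally show ?thesis by (simp add: power_potential_def)
    qed
    show "ennreal_powr (h y) q
        \<le> ennreal_powr (u y) q * ennreal (max 0 (1 - max 0 (1 - enn2real (u y) / enn2real (h y))) powr - q)"
      if fin: "ennreal_powr (u y) q < \<infinity>" for y
    proof (cases "h y = \<infinity>")
      case True
      then show ?thesis using q ennreal_powr_top[of q] by simp
    next
      case False
      obtain U K where UK: "u y = ennreal U" "h y = ennreal K" "0 < U" "U \<le> K"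
        using finite_values[OF fin False] by blast
      have "max 0 (1 - max 0 (1 - enn2real (u y) / enn2real (h y))) = U / K"
        using UK by (simp add: max_def field_simps)
      moreover have "U powr q * (U / K) powr - q = K powr q"
        using UK by (simp add: powr_divide powr_minus field_simps)
      ultimately show ?thesis using UK by (simp add: ennreal_powr_ennreal ennreal_mult[symmetric])
    qed
    \<comment> \<open>The base may vanish at the right endpoint; continuity survives there because
      the exponent \<open>1 - q\<close> is positive.\<close>
    show "continuous_on {0..T / (b * H)} ?\<Phi>"
      using \<tau> q by (intro continuous_intros continuous_on_powr') auto
    show "(?\<Phi> has_real_derivative max 0 (1 - t) powr - q) (at t)" if "0 < t" "t < T / (b * H)" for t
    proof -
      have "t < 1" using that \<tau> by simp
      then show ?thesis
        using q by (auto intro!: derivative_eq_intros simp: max_def)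
    qed
    show "max 0 (1 - t) powr - q \<le> max 0 (1 - s) powr - q" if "s \<le> t" for s t :: real
      using q that by (intro powr_mono2) auto
  qed auto
  also have "?\<Phi> (T / (b * H)) - ?\<Phi> 0 = (1 - (1 - T / (b * H)) powr (1 - q)) / (1 - q)"
    by (simp add: diff_divide_distrib)
  finally show ?thesis .
qed

section \<open>Solving the potential bounds for the potential of \<open>u\<close>\<close>

lemma ereal_powr_ereal: "0 \<le> r \<Longrightarrow> 0 < r \<or> 0 < p \<Longrightarrow> ereal_powr (ereal r) p = ereal (r powr p)"
  by (auto simp: ereal_powr_def)

text \<open>For \<open>q < 1\<close> both multiplication by \<open>1 - q\<close> and the power
  \<open>1 / (1 - q)\<close> preserve order; for \<open>q > 1\<close> both reverse it, so the
  conclusion is the same. With \<open>q > 1\<close> and \<open>c = b * H\<close>, positivity of the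
  base is the strict bound on the potential of the power of \<open>h\<close>.\<close>

lemma one_plus_powr_bound:
  fixes P c \<tau> q :: real
  assumes q: "0 < q" "q \<noteq> 1" and c: "0 < c" and P: "0 \<le> P" and \<tau>: "0 \<le> \<tau>"
    and le: "P \<le> c * ((1 + \<tau>) powr (1 - q) / (1 - q) - 1 / (1 - q))"
  shows "0 < 1 + (1 - q) * P / c" "(1 + (1 - q) * P / c) powr (1 / (1 - q)) \<le> 1 + \<tau>"
proof -
  have "P / c \<le> ((1 + \<tau>) powr (1 - q) - 1) / (1 - q)"
    using le c by (simp add: diff_divide_distrib divide_le_eq mult.commute)
  then have X: "if q < 1 then (1 - q) * P / c \<le> (1 + \<tau>) powr (1 - q) - 1
      else (1 + \<tau>) powr (1 - q) - 1 \<le> (1 - q) * P / c"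
    using q by (auto simp: le_divide_eq mult.commute)
  have pos: "0 < (1 + \<tau>) powr (1 - q)" using \<tau> by simp
  have inv: "((1 + \<tau>) powr (1 - q)) powr (1 / (1 - q)) = 1 + \<tau>"
    using q \<tau> by (simp add: powr_powr)
  show A: "0 < 1 + (1 - q) * P / c"
  proof (cases "q < 1")
    case True
    then have "0 \<le> (1 - q) * P / c" using P c by simp
    then show ?thesis by linarith
  next
    case False
    then have "(1 + \<tau>) powr (1 - q) \<le> 1 + (1 - q) * P / c" using X by simp
    then show ?thesis by (rule less_le_trans[OF pos])
  qed
  show "(1 + (1 - q) * P / c) powr (1 / (1 - q)) \<le> 1 + \<tau>"
  proof (cases "q < 1")
    case True
    then have "(1 + (1 - q) * P / c) powr (1 / (1 - q)) \<le> ((1 + \<tau>) powr (1 - q)) powr (1 / (1 - q))"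
      using X A by (intro powr_mono2) auto
    then show ?thesis by (simp add: inv)
  next
    case False
    then have "(1 + (1 - q) * P / c) powr (1 / (1 - q)) \<le> ((1 + \<tau>) powr (1 - q)) powr (1 / (1 - q))"
      using X pos q by (intro powr_mono2') auto
    then show ?thesis by (simp add: inv)
  qed
qed

text \<open>Here \<open>1 - q\<close> is positive and every step preserves order. The base is only
  nonnegative, since its lower bound \<open>(1 - \<tau>) powr (1 - q)\<close> vanishes for
  \<open>\<tau> = 1\<close>.\<close>

lemma one_minus_powr_bound:
  fixes P c \<tau> q :: real
  assumes q: "q < 0" and c: "0 < c" and \<tau>: "\<tau> \<le> 1"
    and le: "P \<le> c * ((1 - (1 - \<tau>) powr (1 - q)) / (1 - q))"
  shows "0 \<le> 1 - (1 - q) * P / c" "1 - \<tau> \<le> (1 - (1 - q) * P / c) powr (1 / (1 - q))"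
proof -
  have "P / c \<le> (1 - (1 - \<tau>) powr (1 - q)) / (1 - q)"
    using le c by (simp add: divide_le_eq mult.commute)
  then have X: "(1 - \<tau>) powr (1 - q) \<le> 1 - (1 - q) * P / c"
    using q by (simp add: le_divide_eq mult.commute)
  then show "0 \<le> 1 - (1 - q) * P / c" by (rule order.trans[rotated]) simp
  have "1 - \<tau> = ((1 - \<tau>) powr (1 - q)) powr (1 / (1 - q))"
    using q \<tau> by (simp add: powr_powr)
  also have "\<dots> \<le> (1 - (1 - q) * P / c) powr (1 / (1 - q))"
    using X q by (intro powr_mono2) auto
  finally show "1 - \<tau> \<le> (1 - (1 - q) * P / c) powr (1 / (1 - q))" .
qed

theorem theorem1p2:
  fixes \<sigma> :: "'a::t2_space measure"
    and G :: "'a \<Rightarrow> 'a \<Rightarrow> ennreal"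
    and h u :: "'a \<Rightarrow> ennreal"
    and q b :: real
  assumes "locally_compact_space (euclidean :: 'a topology)"
    and "radon_measure \<sigma>"
    and "lower_semicontinuous (\<lambda>(x, y). G x y)"
    and "q \<noteq> 0"
    and "lower_semicontinuous h"
    and "\<forall>x. 0 < h x"
    and "1 \<le> b"
    and "weak_domination_principle G \<sigma> h b"
    and "u \<in> borel_measurable \<sigma>"
    and "L1_loc \<sigma> (\<lambda>y. ennreal_powr (u y) q)"
    and ineq1: "q > 0 \<Longrightarrow> \<forall>x. u x \<ge> power_potential G \<sigma> u q x + h x"
    and ineq2: "q < 0 \<Longrightarrow> \<forall>x. u x + power_potential G \<sigma> u q x \<le> h x"
  shows
    "(q > 0 \<and> q \<noteq> 1 \<longrightarrow>
        (\<forall>x. (if q < 1 then h x < \<infinity> else u x < \<infinity>) \<longrightarrow>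
           enn2ereal (u x) \<ge> enn2ereal (h x) *
             (1 + ereal b *
               (ereal_powr (1 + ereal (1 - q) * enn2ereal (power_potential G \<sigma> h q x) / (ereal b * enn2ereal (h x)))
                  (1 / (1 - q)) - 1))) \<and>
        (q > 1 \<longrightarrow>
          (\<forall>x. u x < \<infinity> \<and> u x \<ge> power_potential G \<sigma> u q x + h x \<longrightarrow>
             power_potential G \<sigma> h q x < ennreal (b / (q - 1)) * h x))) \<and>
     (q = 1 \<longrightarrow>
        (\<forall>x. h x < \<infinity> \<longrightarrow>
           enn2ereal (u x) \<ge> enn2ereal (h x) *
             (1 + ereal b *
               (ereal_exp (ereal (inverse b) *
                  (enn2ereal (potential G \<sigma> h x) / enn2ereal (h x))) - 1)))) \<and>
     (q < 0 \<longrightarrow>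
        (\<forall>x. h x < \<infinity> \<longrightarrow>
           0 \<le> 1 - ereal (1 - q) * enn2ereal (power_potential G \<sigma> h q x) / (ereal b * enn2ereal (h x)) \<and>
           enn2ereal (u x) \<le> enn2ereal (h x) *
             (1 - ereal b *
               (1 - ereal_powr (1 - ereal (1 - q) * enn2ereal (power_potential G \<sigma> h q x) / (ereal b * enn2ereal (h x)))
                  (1 / (1 - q))))) \<and>
        (\<forall>x. u x > 0 \<and> h x < \<infinity> \<and>
             u x + power_potential G \<sigma> u q x \<le> h x \<longrightarrow>
             power_potential G \<sigma> h q x < ennreal (b / (1 - q) * (1 - (1 - inverse b) powr (1 - q))) * h x))"
proof -
  have sets: "sets \<sigma> = sets borel" using assms(2) by (simp add: radon_measure_def)
  have G: "G x \<in> borel_measurable \<sigma>" for x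
    by (rule lower_semicontinuous_borel_measurable[OF sets lower_semicontinuous_section[OF assms(3)]])
  have h: "h \<in> borel_measurable \<sigma>"
    by (rule lower_semicontinuous_borel_measurable[OF sets assms(5)])
  have uq: "(\<lambda>y. ennreal_powr (u y) q) \<in> borel_measurable \<sigma>"
    using assms(10) by (simp add: L1_loc_def)
  have b: "0 < b" "1 \<le> b" using assms(7) by auto
  have h0: "0 < h x" for x using assms(6) by simp
  note super = supersolution_power_potential_le[OF assms(2,8) G h assms(9) uq b(1) _ h0]
  note sub = subsolution_power_potential_le[OF assms(2,8) G h assms(9) uq b(1) _ h0]

  \<comment> \<open>Lower bounds for positive exponents\<close>
  have values_pos: "\<exists>H T. h x = ennreal H \<and> 0 < H \<and> power_potential G \<sigma> u q x = ennreal T \<and> 0 \<le> T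
      \<and> ennreal (T + H) \<le> u x"
    if q: "0 < q" and fin: "u x \<noteq> top" for x
  proof -
    have ineq: "power_potential G \<sigma> u q x + h x \<le> u x" using ineq1[OF q] by simp
    obtain U where U: "u x = ennreal U" using fin by (cases "u x") auto
    obtain H where H: "h x = ennreal H" "0 \<le> H"
      using ineq U by (cases "h x") (auto simp: top_unique)
    obtain T where T: "power_potential G \<sigma> u q x = ennreal T" "0 \<le> T"
      using ineq U by (cases "power_potential G \<sigma> u q x") (auto simp: top_unique)
    show ?thesis using H T h0[of x] ineq by (intro exI[of _ H] exI[of _ T]) simp
  qed

  \<comment> \<open>The arithmetic for \<open>q \<noteq> 1\<close> in real numbers:
    \<open>H\<close>, \<open>T\<close> and \<open>P\<close> are the values at \<open>x\<close> of
    \<open>h\<close> and of the potentials of the powers of \<open>u\<close> and \<open>h\<close>.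
    Inserting \<open>T = b * H * \<tau>\<close> turns a lower bound for \<open>1 + \<tau>\<close>
    into one for \<open>T + H\<close>.\<close>
  have pos: "0 < 1 + (1 - q) * P / (b * H)
      \<and> H * (1 + b * ((1 + (1 - q) * P / (b * H)) powr (1 / (1 - q)) - 1)) \<le> T + H
      \<and> P \<le> b * H * ((1 + T / (b * H)) powr (1 - q) / (1 - q) - 1 / (1 - q))
      \<and> power_potential G \<sigma> h q x = ennreal P \<and> 0 \<le> P"
    if q: "0 < q" "q \<noteq> 1" and H: "h x = ennreal H" "0 < H"
      and T: "power_potential G \<sigma> u q x = ennreal T" "0 \<le> T"
      and P_def: "P = enn2real (power_potential G \<sigma> h q x)" for x H T P
  proof -
    define \<tau> where "\<tau> = T / (b * H)"
    have \<tau>: "0 \<le> \<tau>" "T = b * H * \<tau>" using T H b by (auto simp: \<tau>_def)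
    have le: "power_potential G \<sigma> h q x
        \<le> ennreal (b * H * ((1 + \<tau>) powr (1 - q) / (1 - q) - (1 + 0) powr (1 - q) / (1 - q)))"
      unfolding \<tau>_def
      by (rule super[OF q(1) _ H T]) (use ineq1[OF q(1)] q in \<open>auto intro!: derivative_eq_intros\<close>)
    \<comment> \<open>Without this sign the bound in \<open>ennreal\<close> could not be read as one
      between reals, because \<open>ennreal\<close> sends negative numbers to
      \<open>0\<close>.\<close>
    have nonneg: "0 \<le> (1 + \<tau>) powr (1 - q) / (1 - q) - 1 / (1 - q)"
    proof (cases "q < 1")
      case True
      then have "1 \<le> (1 + \<tau>) powr (1 - q)" using \<tau> by (simp add: ge_one_powr_ge_zero)
      then show ?thesis using True by (simp add: divide_right_mono)
    next
      case False
      then have "(1 + \<tau>) powr (1 - q) \<le> (1 + \<tau>) powr 0" using \<tau> by (intro powr_mono) auto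
      then show ?thesis using False q \<tau> by (simp add: divide_right_mono_neg)
    qed
    have P: "power_potential G \<sigma> h q x = ennreal P" "0 \<le> P"
      using le by (cases "power_potential G \<sigma> h q x"; auto simp: P_def top_unique)+
    have P_le: "P \<le> b * H * ((1 + \<tau>) powr (1 - q) / (1 - q) - 1 / (1 - q))"
      using le nonneg b H unfolding P by (subst (asm) ennreal_le_iff) auto
    have "0 < b * H" using b H by simp
    note bound = one_plus_powr_bound[OF q this P(2) \<tau>(1) P_le]
    have "H * (1 + b * ((1 + (1 - q) * P / (b * H)) powr (1 / (1 - q)) - 1)) \<le> H * (1 + b * (1 + \<tau> - 1))"
      using bound(2) b H by (intro mult_left_mono add_left_mono diff_right_mono) auto
    also have "\<dots> = T + H" by (simp add: \<tau>(2) algebra_simps)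
    finally show ?thesis using bound(1) P P_le by (simp add: \<tau>_def)
  qed

  \<comment> \<open>An infinite \<open>u x\<close> makes the bound trivial; a finite one makes
    \<open>h x\<close> and the potential of the power of \<open>u\<close> finite, so the real
    inequality applies.\<close>
  have part_a: "enn2ereal (h x) * (1 + ereal b *
      (ereal_powr (1 + ereal (1 - q) * enn2ereal (power_potential G \<sigma> h q x) / (ereal b * enn2ereal (h x)))
        (1 / (1 - q)) - 1)) \<le> enn2ereal (u x)"
    if q: "0 < q" "q \<noteq> 1" for x
  proof (cases "u x = top")
    case False
    from values_pos[OF q(1) this] obtain H T where H: "h x = ennreal H" "0 < H"
      and T: "power_potential G \<sigma> u q x = ennreal T" "0 \<le> T" and u: "ennreal (T + H) \<le> u x" by blast
    define P where "P = enn2real (power_potential G \<sigma> h q x)"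
    note * = pos[OF q H T P_def]
    have "enn2ereal (h x) * (1 + ereal b *
      (ereal_powr (1 + ereal (1 - q) * enn2ereal (power_potential G \<sigma> h q x) / (ereal b * enn2ereal (h x)))
        (1 / (1 - q)) - 1)) = ereal (H * (1 + b * ((1 + (1 - q) * P / (b * H)) powr (1 / (1 - q)) - 1)))"
      using * H b by (simp add: one_ereal_def ereal_powr_ereal)
    also have "\<dots> \<le> ereal (T + H)" using * by simp
    also have "\<dots> = enn2ereal (ennreal (T + H))" using H T by (simp del: ennreal_plus)
    also have "\<dots> \<le> enn2ereal (u x)" using u by (simp add: less_eq_ennreal.rep_eq)
    finally show ?thesis .
  qed simp

  have part_a_strict: "power_potential G \<sigma> h q x < ennreal (b / (q - 1)) * h x"
    if q: "1 < q" and u: "u x < \<infinity>" for x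
  proof -
    have q': "0 < q" "q \<noteq> 1" using q by auto
    have "u x \<noteq> top" using u by simp
    from values_pos[OF q'(1) this] obtain H T where H: "h x = ennreal H" "0 < H"
      and T: "power_potential G \<sigma> u q x = ennreal T" "0 \<le> T" by blast
    define P where "P = enn2real (power_potential G \<sigma> h q x)"
    note * = pos[OF q' H T P_def]
    \<comment> \<open>This is \<open>0 < 1 + (1 - q) * P / (b * H)\<close> solved for
      \<open>P\<close>, with \<open>1 - q < 0\<close>.\<close>
    have "P < b / (q - 1) * H"
      using * q b H by (simp add: field_simps)
    then show ?thesis using * q b H by (simp add: ennreal_mult[symmetric] ennreal_less_iff)
  qed

  \<comment> \<open>The exponential bound for \<open>q = 1\<close>\<close>
  have part_b: "enn2ereal (h x) * (1 + ereal b *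
      (ereal_exp (ereal (inverse b) * (enn2ereal (potential G \<sigma> h x) / enn2ereal (h x))) - 1)) \<le> enn2ereal (u x)"
    if q: "q = 1" for x
  proof (cases "u x = top")
    case False
    have q0: "0 < q" using q by simp
    have powr_1: "ennreal_powr v 1 = v" for v
      by (cases v) (auto simp: ennreal_powr_def ereal_powr_def)
    have h_eq: "power_potential G \<sigma> h q x = potential G \<sigma> h x"
      by (simp add: power_potential_def q powr_1)
    from values_pos[OF q0 False] obtain H T where H: "h x = ennreal H" "0 < H"
      and T: "power_potential G \<sigma> u q x = ennreal T" "0 \<le> T" and u: "ennreal (T + H) \<le> u x" by blast
    define \<tau> where "\<tau> = T / (b * H)"
    have \<tau>: "0 \<le> \<tau>" "T = b * H * \<tau>" using T H b by (auto simp: \<tau>_def)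
    \<comment> \<open>For \<open>q = 1\<close> the weight is \<open>1 / (1 + t)\<close> with
      antiderivative \<open>ln (1 + t)\<close>; inverting the logarithm produces the
      exponential.\<close>
    have le: "power_potential G \<sigma> h q x \<le> ennreal (b * H * (ln (1 + \<tau>) - ln (1 + 0)))"
      unfolding \<tau>_def
      by (rule super[OF q0 _ H T]) (use ineq1[OF q0] q in \<open>auto intro!: derivative_eq_intros simp: powr_minus divide_simps\<close>)
    define P where "P = enn2real (potential G \<sigma> h x)"
    have P: "potential G \<sigma> h x = ennreal P" "0 \<le> P"
      using le unfolding h_eq by (cases "potential G \<sigma> h x"; auto simp: P_def top_unique)+
    have "P \<le> b * H * ln (1 + \<tau>)"
      using le \<tau> b H unfolding h_eq P by (subst (asm) ennreal_le_iff) auto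
    then have "inverse b * (P / H) \<le> ln (1 + \<tau>)"
      using b H by (simp add: field_simps)
    then have e: "exp (inverse b * (P / H)) \<le> 1 + \<tau>"
      using \<tau> by (subst ln_ge_iff[symmetric]) auto
    have "H * (1 + b * (exp (inverse b * (P / H)) - 1)) \<le> H * (1 + b * (1 + \<tau> - 1))"
      using e b H by (intro mult_left_mono add_left_mono diff_right_mono) auto
    also have "\<dots> = T + H" by (simp add: \<tau>(2) algebra_simps)
    finally have *: "H * (1 + b * (exp (inverse b * (P / H)) - 1)) \<le> T + H" .
    have "enn2ereal (h x) * (1 + ereal b *
      (ereal_exp (ereal (inverse b) * (enn2ereal (potential G \<sigma> h x) / enn2ereal (h x))) - 1))
      = ereal (H * (1 + b * (exp (inverse b * (P / H)) - 1)))"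
      using P H b by (simp add: one_ereal_def ereal_exp_def)
    also have "\<dots> \<le> ereal (T + H)" using * by simp
    also have "\<dots> = enn2ereal (ennreal (T + H))" using H T by (simp del: ennreal_plus)
    also have "\<dots> \<le> enn2ereal (u x)" using u by (simp add: less_eq_ennreal.rep_eq)
    finally show ?thesis .
  qed simp

  \<comment> \<open>Upper bounds for negative exponents\<close>
  have part_c: "\<exists>H T U P. h x = ennreal H \<and> 0 < H \<and> u x = ennreal U \<and> 0 \<le> U
      \<and> power_potential G \<sigma> h q x = ennreal P \<and> 0 \<le> P \<and> 0 \<le> T \<and> U + T \<le> H
      \<and> P \<le> b * H * ((1 - (1 - T / (b * H)) powr (1 - q)) / (1 - q))"
    if q: "q < 0" and fin: "h x < \<infinity>" for x
  proof -
    have ineq: "u x + power_potential G \<sigma> u q x \<le> h x" using ineq2[OF q] by simp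
    obtain H where H: "h x = ennreal H" "0 \<le> H" using fin by (cases "h x") auto
    have H0: "0 < H" using h0[of x] H by simp
    obtain U where U: "u x = ennreal U" "0 \<le> U"
      using ineq H by (cases "u x") (auto simp: top_unique)
    obtain T where T: "power_potential G \<sigma> u q x = ennreal T" "0 \<le> T"
      using ineq H by (cases "power_potential G \<sigma> u q x") (auto simp: top_unique)
    have UT: "U + T \<le> H" using ineq H U T by (simp flip: ennreal_plus)
    \<comment> \<open>As \<open>b \<ge> 1\<close>, the chain \<open>T \<le> H \<le> b * H\<close>
      places \<open>T / (b * H)\<close> in \<open>{0..1}\<close>, as the subsolution bound
      requires.\<close>
    have bH: "H \<le> b * H" "0 < b * H" using b H0 mult_right_mono[of 1 b H] by auto
    have \<tau>: "T / (b * H) \<le> 1" "0 \<le> T / (b * H)" using UT U T bH by (auto simp: divide_le_eq)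
    have le: "power_potential G \<sigma> h q x \<le> ennreal (b * H * ((1 - (1 - T / (b * H)) powr (1 - q)) / (1 - q)))"
      by (rule sub[OF q _ H(1) H0 T]) (use ineq2[OF q] UT U bH in auto)
    define P where "P = enn2real (power_potential G \<sigma> h q x)"
    have P: "power_potential G \<sigma> h q x = ennreal P" "0 \<le> P"
      using le by (cases "power_potential G \<sigma> h q x"; auto simp: P_def top_unique)+
    have "(1 - T / (b * H)) powr (1 - q) \<le> 1" using \<tau> q by (intro powr_le1) auto
    then have "P \<le> b * H * ((1 - (1 - T / (b * H)) powr (1 - q)) / (1 - q))"
      using le q b H0 unfolding P by (subst (asm) ennreal_le_iff) auto
    then show ?thesis using H(1) H0 U T(2) P UT by blast
  qed

  have part_c_bound: "0 \<le> 1 - ereal (1 - q) * enn2ereal (power_potential G \<sigma> h q x) / (ereal b * enn2ereal (h x))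
    \<and> enn2ereal (u x) \<le> enn2ereal (h x) * (1 - ereal b *
      (1 - ereal_powr (1 - ereal (1 - q) * enn2ereal (power_potential G \<sigma> h q x) / (ereal b * enn2ereal (h x)))
        (1 / (1 - q))))"
    if q: "q < 0" and fin: "h x < \<infinity>" for x
  proof -
    from part_c[OF that] obtain H T U P where H: "h x = ennreal H" "0 < H" and U: "u x = ennreal U" "0 \<le> U"
      and P: "power_potential G \<sigma> h q x = ennreal P" "0 \<le> P" and T: "0 \<le> T" and UT: "U + T \<le> H"
      and P_le: "P \<le> b * H * ((1 - (1 - T / (b * H)) powr (1 - q)) / (1 - q))"
      by blast
    define \<tau> where "\<tau> = T / (b * H)"
    have T_eq: "T = b * H * \<tau>" using H b by (simp add: \<tau>_def)
    have bH: "H \<le> b * H" "0 < b * H" using b H mult_right_mono[of 1 b H] by auto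
    have "\<tau> \<le> 1" using UT U bH by (auto simp: \<tau>_def divide_le_eq)
    note * = one_minus_powr_bound[OF q bH(2) this P_le[folded \<tau>_def]]
    \<comment> \<open>The right side is \<open>H - T\<close>, written so that it increases with
      \<open>1 - \<tau>\<close>, for which an upper bound is available.\<close>
    have "U \<le> H * (1 - b * (1 - (1 - \<tau>)))" using UT by (simp add: T_eq algebra_simps)
    also have "\<dots> \<le> H * (1 - b * (1 - (1 - (1 - q) * P / (b * H)) powr (1 / (1 - q))))"
      using *(2) b H by (intro mult_left_mono diff_left_mono) auto
    finally show ?thesis
      using *(1) q U P H b by (simp add: one_ereal_def ereal_powr_ereal)
  qed

  have part_c_strict: "power_potential G \<sigma> h q x < ennreal (b / (1 - q) * (1 - (1 - inverse b) powr (1 - q))) * h x"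
    if q: "q < 0" and u: "0 < u x" and fin: "h x < \<infinity>" for x
  proof -
    from part_c[OF q fin] obtain H T U P where H: "h x = ennreal H" "0 < H" and U: "u x = ennreal U" "0 \<le> U"
      and P: "power_potential G \<sigma> h q x = ennreal P" "0 \<le> P" and T: "0 \<le> T" and UT: "U + T \<le> H"
      and P_le: "P \<le> b * H * ((1 - (1 - T / (b * H)) powr (1 - q)) / (1 - q))"
      by blast
    \<comment> \<open>Positivity of \<open>u x\<close> makes \<open>\<tau> = T / (b * H)\<close>
      strictly smaller than \<open>1 / b\<close>. The bound on \<open>P\<close> increases strictly
      in \<open>\<tau>\<close>, and its value at \<open>1 / b\<close> is the asserted constant times
      \<open>H\<close>.\<close>
    have "T < H" using u U UT by simp
    then have "T / (b * H) < inverse b" using b H by (simp add: field_simps)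
    moreover have "inverse b \<le> 1" using b by (simp add: inverse_le_1_iff)
    ultimately have "(1 - inverse b) powr (1 - q) < (1 - T / (b * H)) powr (1 - q)"
      using q by (intro powr_less_mono2) auto
    then have "b * H * ((1 - (1 - T / (b * H)) powr (1 - q)) / (1 - q))
        < b * H * ((1 - (1 - inverse b) powr (1 - q)) / (1 - q))"
      using b H q by (intro mult_strict_left_mono divide_strict_right_mono) auto
    then have less: "P < b / (1 - q) * (1 - (1 - inverse b) powr (1 - q)) * H"
      using P_le by (simp add: mult_ac)
    \<comment> \<open>The sign of the constant is read off from \<open>0 \<le> P\<close> and
      \<open>H > 0\<close>; it is needed to multiply inside \<open>ennreal\<close>.\<close>
    then have "0 \<le> b / (1 - q) * (1 - (1 - inverse b) powr (1 - q))"
      using P(2) H by (metis less_eq_real_def order_le_less_trans zero_less_mult_pos2)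
    then show ?thesis using less P H by (simp add: ennreal_mult[symmetric] ennreal_less_iff)
  qed

  show ?thesis
    using part_a part_a_strict part_b part_c_bound part_c_strict by (auto simp del: infinity_ennreal_def)
qed

end
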